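(* Set $\lambda=0$. Let $k,\ell\ge1$, $p=k+\ell$, $\alpha\in(0,1)$, and let $V_1=(X_1^\top\ R_1^\top)^\top$ ($X_1\in\mathbb{R}^k$, $R_1\in\mathbb{R}^\ell$) follow an elliptical distribution with density $f(v)\propto g((v-\mu)^\top\boldsymbol\Sigma^{-1}(v-\mu))$, where $\mu\in\mathbb{R}^p$, $g:\mathbb{R}_+\to\mathbb{R}_+$ is non-increasing, $V_1$ has finite second moments and $\boldsymbol\Sigma=\mathrm{Cov}(V_1)$ is positive definite. Then, almost surely, $$\mathrm{Vol}(\mathcal F_\alpha^\infty)\le\mathrm{Vol}(\mathcal B_\alpha^\infty).$$
   Context: $q_{1-\alpha}(\xi)=\inf\{r\in\mathbb{R}:\mathbb{P}(\xi>r)\le\alpha\}$. $\boldsymbol\Sigma=\begin{pmatrix}\boldsymbol\Sigma^{11}&\boldsymbol\Sigma^{12}\\ \boldsymbol\Sigma^{21}&\boldsymbol\Sigma^{22}\end{pmatrix}$ in blocks according to $p=k+\ell$; $\boldsymbol{\mathcal A}_\infty=\boldsymbol\Sigma/\boldsymbol\Sigma^{11}=\boldsymbol\Sigma^{22}-\boldsymbol\Sigma^{21}(\boldsymbol\Sigma^{11})^{-1}\boldsymbol\Sigma^{12}$; $X_{\mathrm c}=X_1-\mathbb{E}X_1$, $R_{\mathrm c}=R_1-\mathbb{E}R_1$; $T_{\mathrm c}=R_{\mathrm c}-\boldsymbol\Sigma^{21}(\boldsymbol\Sigma^{11})^{-1}X_{\mathrm c}$; $q_{1-\alpha}^{\mathcal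 F}=q_{1-\alpha}(T_{\mathrm c}^\top\boldsymbol{\mathcal A}_\infty^{-1}T_{\mathrm c})$; $Z_0^\infty=\boldsymbol\Sigma^{21}(\boldsymbol\Sigma^{11})^{-1}X_{\mathrm c}+\mathbb{E}[R_1]$. The (random) ellipsoid is $\mathcal F_\alpha^\infty=\{z\in\mathbb{R}^\ell:(z-Z_0^\infty)^\top\boldsymbol{\mathcal A}_\infty^{-1}(z-Z_0^\infty)\le q_{1-\alpha}^{\mathcal F}\}$, and $\mathcal B_\alpha^\infty$ is the ball of $\mathbb{R}^\ell$ centered at $0$ with squared radius $q_{1-\alpha}(\|R_1\|^2)$. $\mathrm{Vol}$ is Lebesgue measure on $\mathbb{R}^\ell$. *)

theory Defs
  imports "HOL-Probability.Probability"
begin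

definition stack :: "real ^ 'k \<Rightarrow> real ^ 'l \<Rightarrow> real ^ ('k::finite + 'l::finite)" where
  "stack x r = (\<chi> i. case i of Inl a \<Rightarrow> x $ a | Inr b \<Rightarrow> r $ b)"

definition covariance_matrix :: "'a measure \<Rightarrow> ('a \<Rightarrow> real ^ 'n) \<Rightarrow> real ^ 'n ^ 'n" where
  "covariance_matrix M V = (\<chi> i j. \<integral>\<omega>. (V \<omega> $ i - (\<integral>\<omega>'. V \<omega>' $ i \<partial>M)) *
                                     (V \<omega> $ j - (\<integral>\<omega>'. V \<omega>' $ j \<partial>M)) \<partial>M)"

definition positive_definite :: "real ^ 'n ^ 'n \<Rightarrow> bool" where
  "positive_definite A \<longleftrightarrow> transpose A = A \<and> (\<forall>x. x \<noteq> 0 \<longrightarrow> 0 < x \<bullet> (A *v x))"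

(* Note that real ^ 'n ^ 'm has rows indexed by 'm and columns by 'n. *)

definition block11 :: "real ^ ('k::finite + 'l::finite) ^ ('k::finite + 'l::finite) \<Rightarrow> real ^ 'k ^ 'k" where
  "block11 S = (\<chi> i j. S $ Inl i $ Inl j)"

definition block12 :: "real ^ ('k::finite + 'l::finite) ^ ('k::finite + 'l::finite) \<Rightarrow> real ^ 'l ^ 'k" where
  "block12 S = (\<chi> i j. S $ Inl i $ Inr j)"

definition block21 :: "real ^ ('k::finite + 'l::finite) ^ ('k::finite + 'l::finite) \<Rightarrow> real ^ 'k ^ 'l" where
  "block21 S = (\<chi> i j. S $ Inr i $ Inl j)"

definition block22 :: "real ^ ('k::finite + 'l::finite) ^ ('k::finite + 'l::finite) \<Rightarrow> real ^ 'l ^ 'l" where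
  "block22 S = (\<chi> i j. S $ Inr i $ Inr j)"

definition schur_complement :: "real ^ ('k::finite + 'l::finite) ^ ('k::finite + 'l::finite) \<Rightarrow> real ^ 'l ^ 'l" where
  "schur_complement S = block22 S - block21 S ** matrix_inv (block11 S) ** block12 S"

(* q_{1-\<alpha>}(\<xi>); for 0 < \<alpha> < 1 the set is nonempty and bounded below, so Inf is the true infimum. *)
definition upper_quantile :: "'a measure \<Rightarrow> real \<Rightarrow> ('a \<Rightarrow> real) \<Rightarrow> real" where
  "upper_quantile M \<alpha> \<xi> = Inf {r. measure M {\<omega> \<in> space M. \<xi> \<omega> > r} \<le> \<alpha>}"

definition centered :: "'a measure \<Rightarrow> ('a \<Rightarrow> real ^ 'n) \<Rightarrow> 'a \<Rightarrow> real ^ 'n" where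
  "centered M Y \<omega> = Y \<omega> - (\<integral>\<omega>'. Y \<omega>' \<partial>M)"

definition joint_cov ::
  "'a measure \<Rightarrow> ('a \<Rightarrow> real ^ 'k) \<Rightarrow> ('a \<Rightarrow> real ^ 'l) \<Rightarrow> real ^ ('k::finite + 'l::finite) ^ ('k::finite + 'l::finite)" where
  "joint_cov M X R = covariance_matrix M (\<lambda>\<omega>. stack (X \<omega>) (R \<omega>))"

definition A_inf :: "'a measure \<Rightarrow> ('a \<Rightarrow> real ^ 'k) \<Rightarrow> ('a \<Rightarrow> real ^ 'l) \<Rightarrow> real ^ 'l ^ 'l" where
  "A_inf M X R = schur_complement (joint_cov M X R)"

definition regression_matrix ::
  "'a measure \<Rightarrow> ('a \<Rightarrow> real ^ 'k) \<Rightarrow> ('a \<Rightarrow> real ^ 'l) \<Rightarrow> real ^ 'k ^ 'l" where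
  "regression_matrix M X R = block21 (joint_cov M X R) ** matrix_inv (block11 (joint_cov M X R))"

definition T_c :: "'a measure \<Rightarrow> ('a \<Rightarrow> real ^ 'k) \<Rightarrow> ('a \<Rightarrow> real ^ 'l) \<Rightarrow> 'a \<Rightarrow> real ^ 'l" where
  "T_c M X R \<omega> = centered M R \<omega> - regression_matrix M X R *v centered M X \<omega>"

definition Z0_inf :: "'a measure \<Rightarrow> ('a \<Rightarrow> real ^ 'k) \<Rightarrow> ('a \<Rightarrow> real ^ 'l) \<Rightarrow> 'a \<Rightarrow> real ^ 'l" where
  "Z0_inf M X R \<omega> = regression_matrix M X R *v centered M X \<omega> + (\<integral>\<omega>'. R \<omega>' \<partial>M)"

definition q_F :: "'a measure \<Rightarrow> ('a \<Rightarrow> real ^ 'k) \<Rightarrow> ('a \<Rightarrow> real ^ 'l) \<Rightarrow> real \<Rightarrow> real" where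
  "q_F M X R \<alpha> =
     upper_quantile M \<alpha> (\<lambda>\<omega>. T_c M X R \<omega> \<bullet> (matrix_inv (A_inf M X R) *v T_c M X R \<omega>))"

definition F_inf ::
  "'a measure \<Rightarrow> ('a \<Rightarrow> real ^ 'k) \<Rightarrow> ('a \<Rightarrow> real ^ 'l) \<Rightarrow> real \<Rightarrow> 'a \<Rightarrow> (real ^ 'l) set" where
  "F_inf M X R \<alpha> \<omega> =
     {z. (z - Z0_inf M X R \<omega>) \<bullet> (matrix_inv (A_inf M X R) *v (z - Z0_inf M X R \<omega>)) \<le> q_F M X R \<alpha>}"

definition B_inf :: "'a measure \<Rightarrow> ('a \<Rightarrow> real ^ 'l) \<Rightarrow> real \<Rightarrow> (real ^ 'l) set" where
  "B_inf M R \<alpha> = cball 0 (sqrt (upper_quantile M \<alpha> (\<lambda>\<omega>. (norm (R \<omega>))\<^sup>2)))"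

end

theory Submission
  imports Defs
begin

text \<open>
  Write $\Sigma_{ij}$ for the blocks of the covariance matrix, $B = \Sigma_{21} \Sigma_{11}^{-1}$ for the
  regression matrix and $A$ for the Schur complement. The two sets to compare are a ball that
  contains $R$ with probability at least $1 - \alpha$, and (up to translation) the smallest ellipsoid
  of shape $A$ that contains the regression residual $T$ with probability at least $1 - \alpha$. The
  reason for the inequality is that, among all sets of a given volume, the ellipsoid catches the
  residual with a probability that no other set can beat for $R$, even if it is placed optimally.
  
  Indeed, completing the square splits the quadratic form of $\Sigma^{-1}$ into a form in $x$ and the
  form of $A^{-1}$ evaluated at the residual (\<open>inverse_form_block_decomposition\<close>). For fixed $x$ the
  joint density, as a function of $r$, is thus a non-increasing function of the $A^{-1}$-distance of
  $r$ from the prediction $m(x)$. By the bathtub principle (\<open>nn_integral_bathtub\<close>) every set $D$ whose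
  volume is at most that of the ellipsoid $E$ carries at most as much of this slice as the translate
  $m(x) + E$. Integrating over $x$ gives $P(R \in D) \le P(T \in E)$ (\<open>elliptical_concentration\<close>).
  The argument needs the residual to be centred at $\mu$, and $\mu$ is the mean by reflection symmetry
  (\<open>expectation_symmetric_density\<close>).
  
  Suppose now that the ball $D$ of the theorem had smaller volume than the ellipsoid. Its level could
  then be lowered strictly while keeping its volume at least that of $D$ (\<open>ellipsoid_shrink\<close>). The ball
  has probability at least $1 - \alpha$ for $R$, because the quantile is attained, so the smaller
  ellipsoid has probability at least $1 - \alpha$ for $T$. But its level is below the quantile, which
  forces the probability to be less than $1 - \alpha$.
\<close>

section \<open>Block vectors and positive definite block matrices\<close>

definition fst_block :: "real ^ ('k::finite + 'l::finite) \<Rightarrow> real ^ 'k" where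
  "fst_block w = (\<chi> i. w $ Inl i)"

definition snd_block :: "real ^ ('k::finite + 'l::finite) \<Rightarrow> real ^ 'l" where
  "snd_block w = (\<chi> j. w $ Inr j)"

lemma stack_nth [simp]: "stack x r $ Inl i = x $ i" "stack x r $ Inr j = r $ j"
  by (simp_all add: stack_def)

lemma fst_block_nth [simp]: "fst_block w $ i = w $ Inl i"
  by (simp add: fst_block_def)

lemma snd_block_nth [simp]: "snd_block w $ j = w $ Inr j"
  by (simp add: snd_block_def)

lemma fst_block_stack [simp]: "fst_block (stack x r) = x"
  by (simp add: vec_eq_iff)

lemma snd_block_stack [simp]: "snd_block (stack x r) = r"
  by (simp add: vec_eq_iff)

lemma stack_blocks [simp]: "stack (fst_block w) (snd_block w) = w"
  unfolding vec_eq_iff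
proof
  fix i show "stack (fst_block w) (snd_block w) $ i = w $ i" by (cases i) simp_all
qed

lemma stack_eq_iff [simp]: "stack x r = stack x' r' \<longleftrightarrow> x = x' \<and> r = r'"
  by (metis fst_block_stack snd_block_stack)

lemma stack_diff: "stack x r - stack x' r' = stack (x - x') (r - r')"
  unfolding vec_eq_iff
proof
  fix i show "(stack x r - stack x' r') $ i = stack (x - x') (r - r') $ i" by (cases i) simp_all
qed

lemma sum_UNIV_Plus:
  fixes h :: "'k::finite + 'l::finite \<Rightarrow> 'c::comm_monoid_add"
  shows "sum h UNIV = (\<Sum>i\<in>UNIV. h (Inl i)) + (\<Sum>j\<in>UNIV. h (Inr j))"
  using sum.Plus[of "UNIV::'k set" "UNIV::'l set" h] by simp

lemma prod_UNIV_Plus: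
  fixes h :: "'k::finite + 'l::finite \<Rightarrow> 'c::comm_monoid_mult"
  shows "prod h UNIV = (\<Prod>i\<in>UNIV. h (Inl i)) * (\<Prod>j\<in>UNIV. h (Inr j))"
  using prod.Plus[of "UNIV::'k set" "UNIV::'l set" h] by simp

lemma inner_stack: "stack x r \<bullet> stack x' r' = x \<bullet> x' + r \<bullet> r'"
  by (simp add: inner_vec_def sum_UNIV_Plus)

lemma matrix_vector_mult_stack:
  "S *v stack x r =
     stack (block11 S *v x + block12 S *v r) (block21 S *v x + block22 S *v r)"
  unfolding vec_eq_iff
proof
  fix i
  show "(S *v stack x r) $ i =
      stack (block11 S *v x + block12 S *v r) (block21 S *v x + block22 S *v r) $ i"
    by (cases i) (simp_all add: matrix_vector_mult_def sum_UNIV_Plus block11_def block12_def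
        block21_def block22_def)
qed

lemma matrix_inv_invertible:
  fixes A :: "real ^ 'n ^ 'n"
  assumes "invertible A"
  shows "A ** matrix_inv A = mat 1" and "matrix_inv A ** A = mat 1"
  using someI_ex[OF assms[unfolded invertible_def]] by (auto simp: matrix_inv_def)

lemma positive_definite_invertible:
  assumes "positive_definite A"
  shows "invertible A"
proof -
  have "x = 0" if "A *v x = 0" for x
    using assms that unfolding positive_definite_def by (metis inner_zero_right less_irrefl)
  then show ?thesis
    using matrix_left_invertible_ker[of A] invertible_left_inverse[of A] by auto
qed

lemma positive_definite_cancel:
  assumes "positive_definite A"
  shows "A *v (matrix_inv A *v x) = x" and "matrix_inv A *v (A *v x) = x"
  using matrix_inv_invertible[OF positive_definite_invertible[OF assms]]
  by (simp_all add: matrix_vector_mul_assoc)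

lemma inner_matrix_vector_transpose:
  fixes A :: "real ^ 'n ^ 'm"
  shows "x \<bullet> (A *v y) = (transpose A *v x) \<bullet> y"
  by (simp add: dot_lmul_matrix)

lemma inner_matrix_vector_symmetric:
  assumes "positive_definite A"
  shows "x \<bullet> (A *v y) = (A *v x) \<bullet> y"
  using inner_matrix_vector_transpose[of x A y] assms unfolding positive_definite_def by metis

lemma positive_definite_inv_form_pos:
  assumes "positive_definite A" and "x \<noteq> 0"
  shows "0 < x \<bullet> (matrix_inv A *v x)"
proof -
  have "matrix_inv A *v x \<noteq> 0"
    using positive_definite_cancel(1)[OF assms(1), of x] assms(2) by auto
  then have "0 < (matrix_inv A *v x) \<bullet> (A *v (matrix_inv A *v x))"
    using assms(1) unfolding positive_definite_def by blast
  then show ?thesis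
    by (simp add: positive_definite_cancel[OF assms(1)] inner_commute)
qed

lemma positive_definite_inv_form_nonneg:
  assumes "positive_definite A"
  shows "0 \<le> x \<bullet> (matrix_inv A *v x)"
  using positive_definite_inv_form_pos[OF assms, of x] by (cases "x = 0") auto

lemma transpose_block12: "transpose S = S \<Longrightarrow> transpose (block12 S) = block21 S"
  unfolding vec_eq_iff by (simp add: transpose_def block12_def block21_def)

lemma positive_definite_block11:
  assumes "positive_definite S"
  shows "positive_definite (block11 (S :: real ^ ('k::finite + 'l::finite) ^ ('k + 'l)))"
  unfolding positive_definite_def
proof (intro conjI allI impI)
  show "transpose (block11 S) = block11 S"
    using assms unfolding positive_definite_def vec_eq_iff
    by (simp add: transpose_def block11_def)
next
  fix x :: "real ^ 'k" assume "x \<noteq> 0"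
  then have "fst_block (stack x (0 :: real ^ 'l)) \<noteq> fst_block 0"
    by (simp add: fst_block_def vec_eq_iff)
  then have "stack x (0 :: real ^ 'l) \<noteq> 0" by metis
  then have "0 < stack x 0 \<bullet> (S *v stack x 0)"
    using assms by (simp add: positive_definite_def)
  then show "0 < x \<bullet> (block11 S *v x)"
    by (simp add: matrix_vector_mult_stack inner_stack)
qed

lemma schur_complement_mult:
  "schur_complement S *v y =
     block22 S *v y - (block21 S ** matrix_inv (block11 S)) *v (block12 S *v y)"
  by (simp add: schur_complement_def matrix_vector_mult_diff_rdistrib matrix_vector_mul_assoc)

text \<open>
  Since \<open>block12 S\<close> is the transpose of \<open>block21 S\<close> and the inverse of the leading block is
  self-adjoint, the adjoint of the regression matrix can be moved across the inner product.
\<close>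

lemma inner_regression:
  assumes S: "positive_definite S"
  shows "a \<bullet> (matrix_inv (block11 S) *v (block12 S *v y)) =
    ((block21 S ** matrix_inv (block11 S)) *v a) \<bullet> y"
proof -
  note S11 = positive_definite_block11[OF S]
  have "a \<bullet> (matrix_inv (block11 S) *v z) = (matrix_inv (block11 S) *v a) \<bullet> z" for z
    using inner_matrix_vector_symmetric[OF S11, of "matrix_inv (block11 S) *v a" "matrix_inv (block11 S) *v z"]
    by (simp add: positive_definite_cancel[OF S11])
  then show ?thesis
    using inner_matrix_vector_transpose[of "matrix_inv (block11 S) *v a" "block12 S" y]
      transpose_block12[of S] S
    by (simp add: positive_definite_def del: transpose_matrix_vector flip: matrix_vector_mul_assoc)
qed

text \<open>
  Completing the square: with $S_{ij}$ the blocks of $S$, the bilinear form of the Schur complement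
  at $(x, y)$ is the bilinear form of $S$ at the vectors $(-S_{11}^{-1} S_{12} x,\ x)$ and
  $(-S_{11}^{-1} S_{12} y,\ y)$, because the first block of $S$ applied to such a vector vanishes.
  Symmetry and positivity are inherited through this identity.
\<close>

lemma positive_definite_schur_complement:
  assumes S: "positive_definite S"
  shows "positive_definite (schur_complement (S :: real ^ ('k::finite + 'l::finite) ^ ('k + 'l)))"
  unfolding positive_definite_def
proof (intro conjI allI impI)
  note S11 = positive_definite_block11[OF S]
  define A where "A = schur_complement S"
  have neg: "E *v (- x) = - (E *v x)" for E :: "real ^ 'i::finite ^ 'j::finite" and x
    using matrix_vector_mult_diff_distrib[of E 0 x] by simp
  have form: "x \<bullet> (A *v y) = stack (- (matrix_inv (block11 S) *v (block12 S *v x))) x \<bullet>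
      (S *v stack (- (matrix_inv (block11 S) *v (block12 S *v y))) y)" for x y
    by (simp add: A_def schur_complement_mult matrix_vector_mult_stack inner_stack neg
        positive_definite_cancel[OF S11] algebra_simps flip: matrix_vector_mul_assoc)
  have "x \<bullet> (A *v y) = (A *v x) \<bullet> y" for x y
    using inner_matrix_vector_symmetric[OF S] form[of x y] form[of y x] by (metis inner_commute)
  then have "(transpose A *v x) \<bullet> y = (A *v x) \<bullet> y" for x y
    using inner_matrix_vector_transpose[of x A y] by simp
  then have "transpose A *v x = A *v x" for x
    by (metis vector_eq_rdot)
  then show "transpose (schur_complement S) = schur_complement S"
    unfolding A_def by (simp add: matrix_eq)
  fix y :: "real ^ 'l" assume "y \<noteq> 0"
  then have "snd_block (stack (- (matrix_inv (block11 S) *v (block12 S *v y))) y) \<noteq> snd_block 0"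
    by (simp add: snd_block_def vec_eq_iff)
  then have "stack (- (matrix_inv (block11 S) *v (block12 S *v y))) y \<noteq> 0" by metis
  then show "0 < y \<bullet> (schur_complement S *v y)"
    using form[of y y] S by (simp add: A_def positive_definite_def)
qed

text \<open>
  The analytic content of conditioning on the first block. Let $u = S^{-1}(a, b)$ have blocks $u_1$
  and $u_2$. Eliminating $u_1$ from $S u = (a, b)$ gives $b - B a = A u_2$, so the quadratic form of
  the residual $b - B a$ with respect to $A^{-1}$ is $(b - B a) \<bullet> u_2$, while the form of $a$ is
  $a \<bullet> u_1 + B a \<bullet> u_2$; the two add up to $(a, b) \<bullet> u$.
\<close>

lemma inverse_form_block_decomposition:
  assumes S: "positive_definite S"
  defines "A \<equiv> schur_complement S"
    and "B \<equiv> block21 S ** matrix_inv (block11 S)"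
  shows "stack a b \<bullet> (matrix_inv S *v stack a b) =
    a \<bullet> (matrix_inv (block11 S) *v a) + (b - B *v a) \<bullet> (matrix_inv A *v (b - B *v a))"
proof -
  note S11 = positive_definite_block11[OF S]
  have A: "positive_definite A" unfolding A_def by (rule positive_definite_schur_complement[OF S])
  define u where "u = matrix_inv S *v stack a b"
  define u1 u2 where "u1 = fst_block u" and "u2 = snd_block u"
  have u: "u = stack u1 u2" by (simp add: u1_def u2_def)
  have "S *v u = stack a b" by (simp add: u_def positive_definite_cancel[OF S])
  then have ab: "a = block11 S *v u1 + block12 S *v u2" "b = block21 S *v u1 + block22 S *v u2"
    by (simp_all add: u matrix_vector_mult_stack)
  have "B *v a = block21 S *v u1 + B *v (block12 S *v u2)"
    by (simp add: ab(1) B_def matrix_vector_right_distrib positive_definite_cancel[OF S11]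
        flip: matrix_vector_mul_assoc)
  then have t: "b - B *v a = A *v u2"
    by (simp add: ab(2) A_def schur_complement_mult B_def)
  have "a \<bullet> (matrix_inv (block11 S) *v a) = a \<bullet> u1 + (B *v a) \<bullet> u2"
    using inner_regression[OF S, of a u2]
    by (subst (2) ab(1)) (simp add: B_def matrix_vector_right_distrib
        positive_definite_cancel[OF S11] inner_add_right)
  moreover have "(b - B *v a) \<bullet> (matrix_inv A *v (b - B *v a)) = (b - B *v a) \<bullet> u2"
    by (subst (2) t) (simp add: positive_definite_cancel[OF A])
  moreover have "stack a b \<bullet> u = a \<bullet> u1 + b \<bullet> u2" by (simp add: u inner_stack)
  ultimately show ?thesis by (simp add: u_def inner_diff_left)
qed

section \<open>Lebesgue measure on block vectors\<close>

lemma linear_stack: "linear (\<lambda>(x, r). stack x r)"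
proof (rule linearI)
  fix v w :: "(real ^ 'a) \<times> (real ^ 'b)" and t :: real
  show "(case v + w of (x, r) \<Rightarrow> stack x r) = (case v of (x, r) \<Rightarrow> stack x r) + (case w of (x, r) \<Rightarrow> stack x r)"
    unfolding vec_eq_iff
  proof
    fix i
    show "(case v + w of (x, r) \<Rightarrow> stack x r) $ i =
      ((case v of (x, r) \<Rightarrow> stack x r) + (case w of (x, r) \<Rightarrow> stack x r)) $ i"
      by (cases i) (simp_all add: case_prod_beta)
  qed
  show "(case t *\<^sub>R v of (x, r) \<Rightarrow> stack x r) = t *\<^sub>R (case v of (x, r) \<Rightarrow> stack x r)"
    unfolding vec_eq_iff
  proof
    fix i
    show "(case t *\<^sub>R v of (x, r) \<Rightarrow> stack x r) $ i = (t *\<^sub>R (case v of (x, r) \<Rightarrow> stack x r)) $ i"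
      by (cases i) (simp_all add: case_prod_beta)
  qed
qed

lemma linear_fst_block: "linear fst_block"
  by (rule linearI) (simp_all add: vec_eq_iff)

lemma linear_snd_block: "linear snd_block"
  by (rule linearI) (simp_all add: vec_eq_iff)

lemma borel_measurable_linear:
  fixes h :: "'a::euclidean_space \<Rightarrow> 'b::euclidean_space"
  assumes "linear h"
  shows "h \<in> borel_measurable borel"
  using assms by (intro borel_measurable_continuous_onI linear_continuous_on) (simp add: linear_conv_bounded_linear)

lemma measurable_stack [measurable]: "(\<lambda>(x, r). stack x r) \<in> borel_measurable (borel \<Otimes>\<^sub>M borel)"
  using borel_measurable_linear[OF linear_stack] by (simp add: borel_prod)

lemma measurable_fst_block [measurable]: "fst_block \<in> borel_measurable borel"
  and measurable_snd_block [measurable]: "snd_block \<in> borel_measurable borel"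
  by (simp_all add: borel_measurable_linear linear_fst_block linear_snd_block)

lemma prod_Basis_vec:
  fixes h :: "real ^ 'n \<Rightarrow> 'c::comm_monoid_mult"
  shows "prod h Basis = (\<Prod>i\<in>UNIV. h (axis i 1))"
proof -
  have "(Basis :: (real ^ 'n) set) = range (\<lambda>i. axis i 1)"
    by (auto simp: Basis_vec_def)
  moreover have "inj (\<lambda>i. axis i (1::real) :: real ^ 'n)"
    by (auto simp: inj_def axis_eq_axis)
  ultimately show ?thesis by (metis (no_types, lifting) comp_apply prod.cong prod.reindex)
qed

text \<open>
  Stacking two vectors only relabels the coordinates, so it carries boxes to boxes and preserves
  their volume; Lebesgue measure is determined by its values on boxes. This is what makes Fubini
  available for a density on block vectors.
\<close>

lemma lborel_stack:
  "(lborel :: (real ^ ('k::finite + 'l::finite)) measure) =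
     distr (lborel \<Otimes>\<^sub>M lborel) borel (\<lambda>(x, r). stack x r)"
proof (rule lborel_eqI)
  fix l u :: "real ^ ('k + 'l)"
  assume lu: "\<And>b. b \<in> Basis \<Longrightarrow> l \<bullet> b \<le> u \<bullet> b"
  have le: "l $ i \<le> u $ i" for i
    using lu[of "axis i 1"] by (simp add: inner_axis Basis_vec_def axis_eq_axis)
  have box: "(\<lambda>(x, r). stack x r) -` box l u \<inter> space (lborel \<Otimes>\<^sub>M lborel) =
      box (fst_block l) (fst_block u) \<times> box (snd_block l) (snd_block u)"
  proof -
    have "stack x r \<in> box l u \<longleftrightarrow> x \<in> box (fst_block l) (fst_block u) \<and> r \<in> box (snd_block l) (snd_block u)" for x r
      by (auto simp: mem_box_cart space_pair_measure split_sum_all)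
    then show ?thesis by (auto simp: space_pair_measure)
  qed
  have vol: "emeasure lborel (box a b) = (\<Prod>i\<in>UNIV. (b - a) $ i)" if "\<And>i. a $ i \<le> b $ i"
    for a b :: "real ^ 'n"
  proof -
    have "emeasure lborel (box a b) = (\<Prod>i\<in>Basis. (b - a) \<bullet> i)"
      using that by (intro emeasure_lborel_box) (auto simp: Basis_vec_def inner_axis)
    then show ?thesis by (simp add: prod_Basis_vec inner_axis)
  qed
  have "emeasure (distr (lborel \<Otimes>\<^sub>M lborel) borel (\<lambda>(x, r). stack x r)) (box l u) =
      emeasure lborel (box (fst_block l) (fst_block u)) * emeasure lborel (box (snd_block l) (snd_block u))"
    by (subst emeasure_distr) (auto simp: box lborel.emeasure_pair_measure_Times)
  also have "\<dots> = ennreal ((\<Prod>i\<in>UNIV. (u - l) $ Inl i) * (\<Prod>j\<in>UNIV. (u - l) $ Inr j))"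
    using le by (simp add: vol ennreal_mult prod_nonneg)
  also have "\<dots> = ennreal (\<Prod>b\<in>Basis. (u - l) \<bullet> b)"
    by (simp add: prod_Basis_vec prod_UNIV_Plus inner_axis)
  finally show "emeasure (distr (lborel \<Otimes>\<^sub>M lborel) borel (\<lambda>(x, r). stack x r)) (box l u) =
      ennreal (\<Prod>b\<in>Basis. (u - l) \<bullet> b)" .
qed simp

lemma nn_integral_lborel_stack:
  fixes h :: "real ^ ('k::finite + 'l::finite) \<Rightarrow> ennreal"
  assumes [measurable]: "h \<in> borel_measurable borel"
  shows "(\<integral>\<^sup>+v. h v \<partial>lborel) = (\<integral>\<^sup>+x. \<integral>\<^sup>+r. h (stack x r) \<partial>lborel \<partial>lborel)"
proof -
  have "(\<integral>\<^sup>+v. h v \<partial>lborel) = (\<integral>\<^sup>+z. h (case z of (x, r) \<Rightarrow> stack x r) \<partial>(lborel \<Otimes>\<^sub>M lborel))"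
    by (subst lborel_stack, subst nn_integral_distr) simp_all
  also have "\<dots> = (\<integral>\<^sup>+x. \<integral>\<^sup>+r. h (stack x r) \<partial>lborel \<partial>lborel)"
    by (subst lborel.nn_integral_fst[symmetric]) simp_all
  finally show ?thesis .
qed

section \<open>The bathtub principle\<close>

text \<open>
  If $E$ is a superlevel set of \<open>\<phi>\<close>, up to ties at the threshold \<open>\<kappa>\<close>, then among sets of at
  most the same measure $E$ carries the most \<open>\<phi>\<close>-mass: the part $D \setminus E$ has at most the
  measure of $E \setminus D$, and \<open>\<phi>\<close> is at most \<open>\<kappa>\<close> on the former and at least \<open>\<kappa>\<close> on the
  latter. Finiteness of the measure of $E$ is what allows the common part $D \cap E$ to be cancelled.
\<close>

lemma nn_integral_bathtub:
  fixes \<phi> :: "'b \<Rightarrow> ennreal"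
  assumes [measurable]: "\<phi> \<in> borel_measurable N" "D \<in> sets N" "E \<in> sets N"
    and le: "emeasure N D \<le> emeasure N E" and fin: "emeasure N E < \<infinity>"
    and inside: "\<And>x. x \<in> E \<Longrightarrow> \<kappa> \<le> \<phi> x"
    and outside: "\<And>x. x \<in> space N \<Longrightarrow> x \<notin> E \<Longrightarrow> \<phi> x \<le> \<kappa>"
  shows "(\<integral>\<^sup>+x. \<phi> x * indicator D x \<partial>N) \<le> (\<integral>\<^sup>+x. \<phi> x * indicator E x \<partial>N)"
proof -
  (* Used with (U, W) = (D, E) and (E, D), the two decompositions having the same common part. *)
  have split: "(\<integral>\<^sup>+x. \<phi> x * indicator U x \<partial>N) =
      (\<integral>\<^sup>+x. \<phi> x * indicator (D \<inter> E) x \<partial>N) + (\<integral>\<^sup>+x. \<phi> x * indicator (U - W) x \<partial>N)"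
    if [measurable]: "U \<in> sets N" "W \<in> sets N" and "U \<inter> W = D \<inter> E" for U W
    using that(3) by (subst nn_integral_add[symmetric])
      (auto intro!: nn_integral_cong split: split_indicator)
  have "emeasure N D = emeasure N (D \<inter> E) + emeasure N (D - E)"
    "emeasure N E = emeasure N (D \<inter> E) + emeasure N (E - D)"
    by (subst plus_emeasure; auto intro!: arg_cong[where f="emeasure N"])+
  moreover have "emeasure N (D \<inter> E) \<noteq> \<top>"
    using fin emeasure_mono[of "D \<inter> E" E N] by (auto simp: top_unique)
  ultimately have diff: "emeasure N (D - E) \<le> emeasure N (E - D)"
    using le by (simp add: ennreal_add_left_cancel_le)
  have "(\<integral>\<^sup>+x. \<phi> x * indicator (D - E) x \<partial>N) \<le> (\<integral>\<^sup>+x. \<kappa> * indicator (D - E) x \<partial>N)"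
    using outside by (intro nn_integral_mono) (auto split: split_indicator)
  also have "\<dots> = \<kappa> * emeasure N (D - E)" by (simp add: nn_integral_cmult_indicator)
  also have "\<dots> \<le> \<kappa> * emeasure N (E - D)" using diff by (rule mult_left_mono) simp
  also have "\<dots> = (\<integral>\<^sup>+x. \<kappa> * indicator (E - D) x \<partial>N)" by (simp add: nn_integral_cmult_indicator)
  also have "\<dots> \<le> (\<integral>\<^sup>+x. \<phi> x * indicator (E - D) x \<partial>N)"
    using inside by (intro nn_integral_mono) (auto split: split_indicator)
  finally show ?thesis
    by (subst split[of D E], simp, simp, simp, subst split[of E D]) (auto intro: add_left_mono)
qed

section \<open>Quantiles\<close>

text \<open>
  The infimum in the definition of the quantile is attained: the survival function is right
  continuous, and its value just above the infimum is at most \<open>\<alpha>\<close>. The set of admissible levels is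
  nonempty because the survival function tends to $0$, which needs \<open>\<alpha> > 0\<close>.
\<close>

lemma (in prob_space) prob_gt_upper_quantile:
  assumes [measurable]: "random_variable borel \<xi>" and "0 < \<alpha>"
  shows "prob {\<omega> \<in> space M. \<xi> \<omega> > upper_quantile M \<alpha> \<xi>} \<le> \<alpha>"
proof -
  define S where "S = {r. prob {\<omega> \<in> space M. \<xi> \<omega> > r} \<le> \<alpha>}"
  define q where "q = Inf S"
  have "(\<lambda>n. prob {\<omega> \<in> space M. \<xi> \<omega> > real n}) \<longlonglongrightarrow> prob (\<Inter>n. {\<omega> \<in> space M. \<xi> \<omega> > real n})"
    by (rule finite_Lim_measure_decseq) (auto simp: decseq_def)
  moreover have "(\<Inter>n. {\<omega> \<in> space M. \<xi> \<omega> > real n}) = {}"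
  proof (rule equals0I)
    fix \<omega> assume *: "\<omega> \<in> (\<Inter>n. {\<omega> \<in> space M. \<xi> \<omega> > real n})"
    obtain n where "\<xi> \<omega> < real n" using reals_Archimedean2 by blast
    moreover have "\<xi> \<omega> > real n" using * by blast
    ultimately show False by simp
  qed
  ultimately have "\<forall>\<^sub>F n in sequentially. prob {\<omega> \<in> space M. \<xi> \<omega> > real n} < \<alpha>"
    using \<open>0 < \<alpha>\<close> by (auto intro: order_tendstoD)
  then obtain n where "prob {\<omega> \<in> space M. \<xi> \<omega> > real n} < \<alpha>"
    by (auto simp: eventually_sequentially)
  then have ne: "S \<noteq> {}" by (auto simp: S_def intro!: exI[of _ "real n"])
  have above: "prob {\<omega> \<in> space M. \<xi> \<omega> > q + 1 / real (Suc n)} \<le> \<alpha>" for n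
  proof -
    obtain s where "s \<in> S" "s < q + 1 / real (Suc n)"
      using cInf_lessD[OF ne, of "q + 1 / real (Suc n)"] by (auto simp: q_def)
    then have "prob {\<omega> \<in> space M. \<xi> \<omega> > q + 1 / real (Suc n)} \<le> prob {\<omega> \<in> space M. \<xi> \<omega> > s}"
      by (intro finite_measure_mono) auto
    with \<open>s \<in> S\<close> show ?thesis by (simp add: S_def)
  qed
  have "(\<lambda>n. prob {\<omega> \<in> space M. \<xi> \<omega> > q + 1 / real (Suc n)}) \<longlonglongrightarrow>
      prob (\<Union>n. {\<omega> \<in> space M. \<xi> \<omega> > q + 1 / real (Suc n)})"
  proof (rule finite_Lim_measure_incseq)
    show "incseq (\<lambda>n. {\<omega> \<in> space M. \<xi> \<omega> > q + 1 / real (Suc n)})"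
      by (intro incseq_SucI subsetI) (auto elim!: le_less_trans[rotated] intro!: divide_left_mono)
  qed auto
  moreover have "(\<Union>n. {\<omega> \<in> space M. \<xi> \<omega> > q + 1 / real (Suc n)}) = {\<omega> \<in> space M. \<xi> \<omega> > q}"
  proof (intro equalityI subsetI)
    fix \<omega> assume "\<omega> \<in> {\<omega> \<in> space M. \<xi> \<omega> > q}"
    then obtain n where "inverse (real (Suc n)) < \<xi> \<omega> - q" "\<omega> \<in> space M"
      using reals_Archimedean[of "\<xi> \<omega> - q"] by auto
    then show "\<omega> \<in> (\<Union>n. {\<omega> \<in> space M. \<xi> \<omega> > q + 1 / real (Suc n)})"
      by (auto simp: inverse_eq_divide intro!: exI[of _ n])
  next
    fix \<omega> assume "\<omega> \<in> (\<Union>n. {\<omega> \<in> space M. \<xi> \<omega> > q + 1 / real (Suc n)})"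
    then obtain n where "\<omega> \<in> space M" "\<xi> \<omega> > q + 1 / real (Suc n)" by auto
    moreover have "0 < 1 / real (Suc n)" by simp
    ultimately have "\<xi> \<omega> > q" by linarith
    with \<open>\<omega> \<in> space M\<close> show "\<omega> \<in> {\<omega> \<in> space M. \<xi> \<omega> > q}" by simp
  qed
  ultimately have "prob {\<omega> \<in> space M. \<xi> \<omega> > q} \<le> \<alpha>"
    using above by (auto intro: LIMSEQ_le_const2)
  then show ?thesis by (simp add: q_def S_def upper_quantile_def)
qed

text \<open>
  Below the infimum no level is admissible. For this the admissible levels must be bounded below,
  since the infimum of an unbounded set of reals is a junk value; negative levels are exceeded with
  probability $1 > \alpha$.
\<close>

lemma (in prob_space) prob_gt_below_upper_quantile:
  assumes "\<And>\<omega>. 0 \<le> \<xi> \<omega>" and "\<alpha> < 1" and "r < upper_quantile M \<alpha> \<xi>"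
  shows "\<alpha> < prob {\<omega> \<in> space M. \<xi> \<omega> > r}"
proof (rule ccontr)
  define S where "S = {r. prob {\<omega> \<in> space M. \<xi> \<omega> > r} \<le> \<alpha>}"
  assume "\<not> \<alpha> < prob {\<omega> \<in> space M. \<xi> \<omega> > r}"
  then have "r \<in> S" by (simp add: S_def)
  moreover have "bdd_below S"
  proof (rule bdd_belowI)
    fix s assume "s \<in> S"
    show "0 \<le> s"
    proof (rule ccontr)
      assume "\<not> 0 \<le> s"
      then have "{\<omega> \<in> space M. \<xi> \<omega> > s} = space M"
        using assms(1) by (auto intro: less_le_trans[of s 0])
      with \<open>s \<in> S\<close> \<open>\<alpha> < 1\<close> show False by (simp add: S_def prob_space)
    qed
  qed
  ultimately have "Inf S \<le> r" by (rule cInf_lower)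
  with assms(3) show False by (simp add: S_def upper_quantile_def)
qed

lemma (in prob_space) upper_quantile_nonneg:
  assumes [measurable]: "random_variable borel \<xi>" and "\<And>\<omega>. 0 \<le> \<xi> \<omega>" and "0 < \<alpha>" and "\<alpha> < 1"
  shows "0 \<le> upper_quantile M \<alpha> \<xi>"
proof (rule ccontr)
  assume "\<not> 0 \<le> upper_quantile M \<alpha> \<xi>"
  then have "{\<omega> \<in> space M. \<xi> \<omega> > upper_quantile M \<alpha> \<xi>} = space M"
    using assms(2) by (auto intro: less_le_trans[of _ 0])
  with prob_gt_upper_quantile[of \<xi> \<alpha>] assms show False by (simp add: prob_space)
qed

lemma (in prob_space) prob_le_upper_quantile:
  assumes [measurable]: "random_variable borel \<xi>" and "0 < \<alpha>"
  shows "1 - \<alpha> \<le> prob {\<omega> \<in> space M. \<xi> \<omega> \<le> upper_quantile M \<alpha> \<xi>}"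
proof -
  have "{\<omega> \<in> space M. \<xi> \<omega> \<le> q} = space M - {\<omega> \<in> space M. \<xi> \<omega> > q}" for q by auto
  then show ?thesis
    using prob_gt_upper_quantile[OF assms] by (simp add: prob_compl)
qed

lemma (in prob_space) prob_le_below_upper_quantile:
  assumes [measurable]: "random_variable borel \<xi>" and "\<And>\<omega>. 0 \<le> \<xi> \<omega>" and "\<alpha> < 1"
    and "r < upper_quantile M \<alpha> \<xi>"
  shows "prob {\<omega> \<in> space M. \<xi> \<omega> \<le> r} < 1 - \<alpha>"
proof -
  have "{\<omega> \<in> space M. \<xi> \<omega> \<le> r} = space M - {\<omega> \<in> space M. \<xi> \<omega> > r}" by auto
  then show ?thesis
    using prob_gt_below_upper_quantile[of \<xi> \<alpha> r] assms by (simp add: prob_compl)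
qed

section \<open>The mean of a symmetric density\<close>

lemma lborel_reflect:
  fixes \<mu> :: "'b::euclidean_space"
  shows "lborel = distr lborel borel (\<lambda>v. 2 *\<^sub>R \<mu> - v)"
  using lborel_affine[of "-1" "2 *\<^sub>R \<mu>"] by (simp add: density_1)

lemma (in prob_space) integrable_of_square_integrable_norm:
  fixes V :: "'a \<Rightarrow> 'b::euclidean_space"
  assumes [measurable]: "random_variable borel V" and "integrable M (\<lambda>\<omega>. (norm (V \<omega>))\<^sup>2)"
  shows "integrable M V"
  using square_integrable_imp_integrable[of "\<lambda>\<omega>. norm (V \<omega>)"] assms by (simp add: integrable_norm_iff)

text \<open>
  $V$ and $2\mu - V$ have the same density, so $E V = 2 \mu - E V$. It identifies the location
  parameter of an elliptical density with the mean that is used for centring.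
\<close>

lemma (in prob_space) expectation_symmetric_density:
  fixes V :: "'a \<Rightarrow> 'b::euclidean_space"
  assumes dist: "distributed M lborel V (\<lambda>v. ennreal (f v))"
    and nonneg: "\<And>v. 0 \<le> f v"
    and sym: "\<And>v. f (2 *\<^sub>R \<mu> - v) = f v"
    and int: "integrable M V"
  shows "(\<integral>\<omega>. V \<omega> \<partial>M) = \<mu>"
proof (rule euclidean_eqI)
  fix b :: 'b
  have [measurable]: "f \<in> borel_measurable borel"
    using distributed_real_measurable[OF _ dist] nonneg by simp
  have eq: "(\<integral>\<omega>. V \<omega> \<bullet> b \<partial>M) = (\<integral>v. f v * (v \<bullet> b) \<partial>lborel)"
    using distributed_integral[OF dist, of "\<lambda>v. v \<bullet> b"] nonneg by simp
  also have "\<dots> = (\<integral>v. f (2 *\<^sub>R \<mu> - v) * ((2 *\<^sub>R \<mu> - v) \<bullet> b) \<partial>lborel)"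
    by (subst lborel_reflect[of \<mu>], subst integral_distr) simp_all
  also have "\<dots> = (\<integral>\<omega>. (2 *\<^sub>R \<mu> - V \<omega>) \<bullet> b \<partial>M)"
    using distributed_integral[OF dist, of "\<lambda>v. (2 *\<^sub>R \<mu> - v) \<bullet> b"] nonneg by (simp add: sym)
  also have "\<dots> = 2 * (\<mu> \<bullet> b) - (\<integral>\<omega>. V \<omega> \<bullet> b \<partial>M)"
    using int by (simp add: inner_diff_left prob_space)
  finally show "(\<integral>\<omega>. V \<omega> \<partial>M) \<bullet> b = \<mu> \<bullet> b" using int by simp
qed

section \<open>Ellipsoids\<close>

text \<open>
  The shape matrix enters through its inverse, so that for $q > 0$ the semi-axes are the square roots
  of $q$ times the eigenvalues of $A$.
\<close>

definition ellipsoid :: "real ^ 'n ^ 'n \<Rightarrow> real \<Rightarrow> (real ^ 'n) set" where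
  "ellipsoid A q = {z. z \<bullet> (matrix_inv A *v z) \<le> q}"

lemma continuous_on_quadratic_form [continuous_intros]:
  fixes E :: "real ^ 'n ^ 'n"
  shows "continuous_on U (\<lambda>z. z \<bullet> (E *v z))"
  by (intro continuous_intros matrix_vector_mult_linear_continuous_on)

lemma closed_ellipsoid: "closed (ellipsoid A q)"
  unfolding ellipsoid_def by (intro closed_Collect_le continuous_intros)

lemma quadratic_form_scale:
  fixes E :: "real ^ 'n ^ 'n"
  shows "(s *\<^sub>R z) \<bullet> (E *v (s *\<^sub>R z)) = s\<^sup>2 * (z \<bullet> (E *v z))"
  by (simp add: scaleR_matrix_vector_assoc[symmetric] matrix_vector_mult_scaleR power2_eq_square)

text \<open>
  By compactness the form attains a positive minimum on the unit sphere, and by homogeneity this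
  minimum bounds the ratio of the form to the squared norm from below.
\<close>

lemma bounded_ellipsoid:
  assumes A: "positive_definite A"
  shows "bounded (ellipsoid A q)"
proof -
  let ?Q = "\<lambda>z. z \<bullet> (matrix_inv A *v z)"
  have "\<exists>x\<in>sphere 0 1. \<forall>y\<in>sphere 0 1. ?Q x \<le> ?Q y"
    by (intro continuous_attains_inf continuous_intros) auto
  then obtain x where x: "x \<in> sphere 0 1" "\<And>y. y \<in> sphere 0 1 \<Longrightarrow> ?Q x \<le> ?Q y" by blast
  then have pos: "0 < ?Q x"
    by (intro positive_definite_inv_form_pos[OF A]) auto
  have "norm z \<le> sqrt (\<bar>q\<bar> / ?Q x)" if "?Q z \<le> q" for z
  proof (cases "z = 0")
    case False
    then have "z = norm z *\<^sub>R sgn z" "sgn z \<in> sphere 0 1" by (simp_all add: sgn_div_norm)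
    then have "(norm z)\<^sup>2 * ?Q x \<le> ?Q z"
      using x(2)[of "sgn z"] quadratic_form_scale[of "norm z" "sgn z" "matrix_inv A"]
      by (metis mult_left_mono zero_le_power2)
    then have "(norm z)\<^sup>2 \<le> \<bar>q\<bar> / ?Q x" using that pos by (simp add: pos_le_divide_eq)
    then show ?thesis by (rule real_le_rsqrt)
  qed (use pos in simp)
  then show ?thesis unfolding ellipsoid_def bounded_iff by blast
qed

lemma emeasure_ellipsoid_translate:
  "emeasure lebesgue {z. (z - m) \<bullet> (matrix_inv A *v (z - m)) \<le> q} = emeasure lebesgue (ellipsoid A q)"
proof -
  have "{z. (z - m) \<bullet> (matrix_inv A *v (z - m)) \<le> q} = (\<lambda>z. 1 *\<^sub>R z + m) ` ellipsoid A q"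
    by (force simp: ellipsoid_def image_iff intro!: exI[of _ "_ - m"])
  then show ?thesis using emeasure_lebesgue_affine[of 1 m "ellipsoid A q"] by simp
qed

text \<open>
  The volume depends continuously on the level, since scaling the ellipsoid by $s$ multiplies its
  volume by a power of $s$ and the level by $s^2$. Hence an ellipsoid strictly larger than $D$ can be
  shrunk to a strictly smaller level without losing that comparison. A level $q \le 0$ is excluded,
  because then the ellipsoid has at most one point.
\<close>

lemma ellipsoid_shrink:
  assumes A: "positive_definite A" and less: "emeasure lebesgue D < emeasure lebesgue (ellipsoid A q)"
  shows "\<exists>q'. 0 \<le> q' \<and> q' < q \<and> emeasure lebesgue D \<le> emeasure lebesgue (ellipsoid A q')"
proof -
  let ?n = "DIM(real ^ 'a)"
  have "0 < q"
  proof (rule ccontr)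
    assume "\<not> 0 < q"
    then have "ellipsoid A q \<subseteq> {0}"
      using positive_definite_inv_form_pos[OF A] by (force simp: ellipsoid_def)
    then have "emeasure lebesgue (ellipsoid A q) \<le> emeasure lebesgue {0 :: real ^ 'a}"
      by (intro emeasure_mono) auto
    with less show False by simp
  qed
  have "emeasure lborel (ellipsoid A q) < \<infinity>"
    by (rule emeasure_bounded_finite[OF bounded_ellipsoid[OF A]])
  then obtain v where v: "emeasure lebesgue (ellipsoid A q) = ennreal v" "0 \<le> v"
    by (cases "emeasure lborel (ellipsoid A q)") (auto simp: borel_closed[OF closed_ellipsoid])
  moreover obtain d where d: "emeasure lebesgue D = ennreal d" "0 \<le> d"
    using less by (cases "emeasure lebesgue D") auto
  ultimately have "d < v" using less by (simp add: ennreal_less_iff)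
  (* The scaling factor for which the volume becomes the midpoint of d and v. *)
  define s where "s = root ?n ((d / v + 1) / 2)"
  have "0 < (d / v + 1) / 2" "(d / v + 1) / 2 < 1" "d \<le> (d / v + 1) / 2 * v"
    using \<open>d < v\<close> \<open>0 \<le> d\<close> by (simp_all add: field_simps add_pos_nonneg)
  then have s: "0 < s" "s < 1" "s ^ ?n = (d / v + 1) / 2" "d \<le> s ^ ?n * v"
    by (simp_all add: s_def)
  have "ellipsoid A (s\<^sup>2 * q) = (\<lambda>z. s *\<^sub>R z + 0) ` ellipsoid A q"
  proof (intro equalityI subsetI)
    fix z assume "z \<in> ellipsoid A (s\<^sup>2 * q)"
    then have "(1 / s) *\<^sub>R z \<in> ellipsoid A q"
      using s(1) unfolding ellipsoid_def mem_Collect_eq quadratic_form_scale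
      by (simp add: power_divide field_simps)
    then show "z \<in> (\<lambda>z. s *\<^sub>R z + 0) ` ellipsoid A q"
      using s(1) by (auto intro!: image_eqI[of _ _ "(1 / s) *\<^sub>R z"])
  next
    fix z assume "z \<in> (\<lambda>z. s *\<^sub>R z + 0) ` ellipsoid A q"
    then obtain y where "z = s *\<^sub>R y" "y \<bullet> (matrix_inv A *v y) \<le> q"
      by (auto simp: ellipsoid_def)
    then show "z \<in> ellipsoid A (s\<^sup>2 * q)"
      unfolding ellipsoid_def mem_Collect_eq using quadratic_form_scale[of s y "matrix_inv A"]
      by (simp add: mult_left_mono)
  qed
  then have "emeasure lebesgue (ellipsoid A (s\<^sup>2 * q)) = ennreal (s ^ ?n * v)"
    using emeasure_lebesgue_affine[of s 0 "ellipsoid A q"] s v by (simp add: ennreal_mult ennreal_power)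
  then have "emeasure lebesgue D \<le> emeasure lebesgue (ellipsoid A (s\<^sup>2 * q))"
    using d s(4) by (simp add: ennreal_leI)
  moreover have "s\<^sup>2 * q < q" using s \<open>0 < q\<close> by (simp add: power_less_one_iff)
  ultimately show ?thesis using \<open>0 < q\<close> by (intro exI[of _ "s\<^sup>2 * q"]) auto
qed

section \<open>Concentration of elliptical distributions\<close>

text \<open>
  With $x$ fixed, the block decomposition shows that the density at \<open>stack x r\<close> is a non-increasing
  function of the form of $r - m$ with respect to $A^{-1}$, where $m$ is the regression prediction at
  $x$. The ellipsoid centred at $m$ is therefore a superlevel set of the slice up to ties, whatever
  $x$ is, and the bathtub principle applies.
\<close>

lemma elliptical_slice_bathtub:
  fixes S :: "real ^ ('k::finite + 'l::finite) ^ ('k + 'l)" and \<mu> :: "real ^ ('k + 'l)"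
  defines "A \<equiv> schur_complement S" and "B \<equiv> block21 S ** matrix_inv (block11 S)"
  assumes S: "positive_definite S"
    and decr: "\<And>s t. 0 \<le> s \<Longrightarrow> s \<le> t \<Longrightarrow> g t \<le> g s" and "0 < c"
    and f: "\<And>v. f v = c * g ((v - \<mu>) \<bullet> (matrix_inv S *v (v - \<mu>)))"
    and f_meas [measurable]: "f \<in> borel_measurable borel"
    and D [measurable]: "D \<in> sets borel" and "0 \<le> q"
    and vol: "emeasure lebesgue D \<le> emeasure lebesgue (ellipsoid A q)"
    and m: "m = snd_block \<mu> + B *v (x - fst_block \<mu>)"
  shows "(\<integral>\<^sup>+r. ennreal (f (stack x r)) * indicator D r \<partial>lborel) \<le>
    (\<integral>\<^sup>+r. ennreal (f (stack x r)) * indicator {r. r - m \<in> ellipsoid A q} r \<partial>lborel)"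
proof -
  have A: "positive_definite A" unfolding A_def by (rule positive_definite_schur_complement[OF S])
  define Q where "Q = (\<lambda>z. z \<bullet> (matrix_inv A *v z))"
  define h where "h = (x - fst_block \<mu>) \<bullet> (matrix_inv (block11 S) *v (x - fst_block \<mu>))"
  define E where "E = {r. r - m \<in> ellipsoid A q}"
  have E_eq: "E = {r. (r - m) \<bullet> (matrix_inv A *v (r - m)) \<le> q}"
    by (simp add: E_def ellipsoid_def)
  have h: "0 \<le> h" unfolding h_def
    by (rule positive_definite_inv_form_nonneg[OF positive_definite_block11[OF S]])
  have Q: "0 \<le> Q z" for z unfolding Q_def by (rule positive_definite_inv_form_nonneg[OF A])
  have f_slice: "f (stack x r) = c * g (h + Q (r - m))" for r
  proof -
    have "stack x r - \<mu> = stack (x - fst_block \<mu>) (r - snd_block \<mu>)"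
      using stack_diff[of x r "fst_block \<mu>" "snd_block \<mu>"] by simp
    moreover have "r - snd_block \<mu> - B *v (x - fst_block \<mu>) = r - m" by (simp add: m)
    ultimately show ?thesis
      by (simp only: f h_def Q_def inverse_form_block_decomposition[OF S, folded A_def B_def])
  qed
  have E_closed: "closed E"
  proof -
    have "E = (\<lambda>z. m + z) ` ellipsoid A q"
      by (auto simp: E_def image_iff intro!: bexI[of _ "_ - m"])
    then show ?thesis using closed_translation[OF closed_ellipsoid, of m A q] by simp
  qed
  then have [measurable]: "E \<in> sets borel" by (rule borel_closed)
  have volE: "emeasure lborel E = emeasure lborel (ellipsoid A q)"
    using emeasure_ellipsoid_translate[of m A q] borel_closed[OF closed_ellipsoid, of A q]
      \<open>E \<in> sets borel\<close> by (simp add: E_eq)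
  show ?thesis
    unfolding E_def[symmetric]
  proof (rule nn_integral_bathtub[where \<kappa> = "ennreal (c * g (h + q))"])
    show "(\<lambda>r. ennreal (f (stack x r))) \<in> borel_measurable lborel" by measurable
    show "D \<in> sets lborel" "E \<in> sets lborel" by simp_all
    show "emeasure lborel D \<le> emeasure lborel E"
      using vol borel_closed[OF closed_ellipsoid, of A q] by (simp add: volE)
    show "emeasure lborel E < \<infinity>"
      unfolding volE by (rule emeasure_bounded_finite[OF bounded_ellipsoid[OF A]])
    show "ennreal (c * g (h + q)) \<le> ennreal (f (stack x r))" if "r \<in> E" for r
      using that \<open>0 < c\<close> h Q[of "r - m"] unfolding f_slice
      by (intro ennreal_leI mult_left_mono decr) (auto simp: E_eq Q_def)
    show "ennreal (f (stack x r)) \<le> ennreal (c * g (h + q))" if "r \<notin> E" for r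
      using that \<open>0 < c\<close> h \<open>0 \<le> q\<close> unfolding f_slice
      by (intro ennreal_leI mult_left_mono decr) (auto simp: E_eq Q_def)
  qed
qed

lemma distributed_stack_emeasure:
  fixes X :: "'a \<Rightarrow> real ^ 'k::finite" and R :: "'a \<Rightarrow> real ^ 'l::finite"
  assumes dist: "distributed M lborel (\<lambda>\<omega>. stack (X \<omega>) (R \<omega>)) f"
    and C [measurable]: "C \<in> sets borel"
  shows "emeasure M {\<omega> \<in> space M. stack (X \<omega>) (R \<omega>) \<in> C} =
    (\<integral>\<^sup>+x. \<integral>\<^sup>+r. f (stack x r) * indicator C (stack x r) \<partial>lborel \<partial>lborel)"
proof -
  have [measurable]: "f \<in> borel_measurable borel"
    using distributed_borel_measurable[OF dist] by simp
  have "{\<omega> \<in> space M. stack (X \<omega>) (R \<omega>) \<in> C} = (\<lambda>\<omega>. stack (X \<omega>) (R \<omega>)) -` C \<inter> space M"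
    by auto
  then show ?thesis
    using distributed_emeasure[OF dist, of C] nn_integral_lborel_stack[of "\<lambda>v. f v * indicator C v"]
    by simp
qed

text \<open>
  The residual is at least as concentrated in an ellipsoid of shape $A$ as the second block is in any
  set of no larger volume. In each slice the event that the residual lies in the ellipsoid is the
  event that the second block lies in a translate of it, so integrating the slicewise inequality over
  the first block suffices.
\<close>

lemma elliptical_concentration:
  fixes S :: "real ^ ('k::finite + 'l::finite) ^ ('k + 'l)" and \<mu> :: "real ^ ('k + 'l)"
    and X :: "'a \<Rightarrow> real ^ 'k" and R :: "'a \<Rightarrow> real ^ 'l"
  defines "A \<equiv> schur_complement S" and "B \<equiv> block21 S ** matrix_inv (block11 S)"
  assumes S: "positive_definite S"
    and nonneg: "\<And>t. 0 \<le> t \<Longrightarrow> 0 \<le> g t"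
    and decr: "\<And>s t. 0 \<le> s \<Longrightarrow> s \<le> t \<Longrightarrow> g t \<le> g s" and "0 < c"
    and f: "\<And>v. f v = c * g ((v - \<mu>) \<bullet> (matrix_inv S *v (v - \<mu>)))"
    and dist: "distributed M lborel (\<lambda>\<omega>. stack (X \<omega>) (R \<omega>)) (\<lambda>v. ennreal (f v))"
    and D [measurable]: "D \<in> sets borel" and "0 \<le> q"
    and vol: "emeasure lebesgue D \<le> emeasure lebesgue (ellipsoid A q)"
  shows "emeasure M {\<omega> \<in> space M. R \<omega> \<in> D} \<le>
    emeasure M {\<omega> \<in> space M. R \<omega> - snd_block \<mu> - B *v (X \<omega> - fst_block \<mu>) \<in> ellipsoid A q}"
proof -
  have "0 \<le> f v" for v
    unfolding f using \<open>0 < c\<close> nonneg positive_definite_inv_form_nonneg[OF S] by simp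
  then have f_meas [measurable]: "f \<in> borel_measurable borel"
    using distributed_real_measurable[OF _ dist] by simp
  define T where "T = (\<lambda>v :: real ^ ('k + 'l). snd_block v - snd_block \<mu> - B *v (fst_block v - fst_block \<mu>))"
  have [measurable]: "(\<lambda>z. B *v z) \<in> borel_measurable borel"
    by (intro borel_measurable_linear matrix_vector_mul_linear)
  have T_meas: "T \<in> borel_measurable borel" unfolding T_def by measurable
  have sets: "snd_block -` D \<in> sets borel" "T -` ellipsoid A q \<in> sets borel"
    using measurable_sets[OF measurable_snd_block D]
      measurable_sets[OF T_meas borel_closed[OF closed_ellipsoid]] by simp_all
  have "emeasure M {\<omega> \<in> space M. R \<omega> \<in> D} =
      (\<integral>\<^sup>+x. \<integral>\<^sup>+r. ennreal (f (stack x r)) * indicator D r \<partial>lborel \<partial>lborel)"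
    using distributed_stack_emeasure[OF dist sets(1)] by (simp add: indicator_vimage)
  also have "\<dots> \<le> (\<integral>\<^sup>+x. \<integral>\<^sup>+r. ennreal (f (stack x r)) *
      indicator {r. r - (snd_block \<mu> + B *v (x - fst_block \<mu>)) \<in> ellipsoid A q} r \<partial>lborel \<partial>lborel)"
    unfolding A_def B_def
    by (intro nn_integral_mono elliptical_slice_bathtub[OF S decr \<open>0 < c\<close> f f_meas D \<open>0 \<le> q\<close>])
       (use vol in \<open>simp_all add: A_def\<close>)
  also have "\<dots> = (\<integral>\<^sup>+x. \<integral>\<^sup>+r. ennreal (f (stack x r)) *
      indicator (T -` ellipsoid A q) (stack x r) \<partial>lborel \<partial>lborel)"
    by (intro nn_integral_cong) (simp add: indicator_def T_def diff_diff_eq)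
  also have "\<dots> = emeasure M {\<omega> \<in> space M. T (stack (X \<omega>) (R \<omega>)) \<in> ellipsoid A q}"
    using distributed_stack_emeasure[OF dist sets(2)] by simp
  finally show ?thesis by (simp add: T_def)
qed

theorem proposition4p10:
  fixes M :: "'a measure"
    and X :: "'a \<Rightarrow> real ^ 'k" and R :: "'a \<Rightarrow> real ^ 'l"
    and \<mu> :: "real ^ ('k + 'l)" and g :: "real \<Rightarrow> real"
    and f :: "real ^ ('k + 'l) \<Rightarrow> real" and c \<alpha> :: real
  assumes "prob_space M"
    and "0 < \<alpha>" and "\<alpha> < 1"
    and "\<And>t. 0 \<le> t \<Longrightarrow> 0 \<le> g t"
    and "\<And>s t. 0 \<le> s \<Longrightarrow> s \<le> t \<Longrightarrow> g t \<le> g s"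
    and "0 < c"
    and "\<And>v. f v = c * g ((v - \<mu>) \<bullet> (matrix_inv (joint_cov M X R) *v (v - \<mu>)))"
    and "distributed M lborel (\<lambda>\<omega>. stack (X \<omega>) (R \<omega>)) (\<lambda>v. ennreal (f v))"
    and "integrable M (\<lambda>\<omega>. (norm (stack (X \<omega>) (R \<omega>)))\<^sup>2)"
    and "positive_definite (joint_cov M X R)"
  shows "AE \<omega> in M. emeasure lebesgue (F_inf M X R \<alpha> \<omega>) \<le> emeasure lebesgue (B_inf M R \<alpha>)"
proof -
  interpret prob_space M by fact
  note nonneg = assms(4) and decr = assms(5) and f = assms(7) and dist = assms(8) and S = assms(10)
  define A where "A = A_inf M X R"
  define B where "B = regression_matrix M X R"
  define q where "q = q_F M X R \<alpha>"
  define b where "b = upper_quantile M \<alpha> (\<lambda>\<omega>. (norm (R \<omega>))\<^sup>2)"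
  have A: "positive_definite A"
    unfolding A_def A_inf_def by (rule positive_definite_schur_complement[OF S])
  have V_meas [measurable]: "(\<lambda>\<omega>. stack (X \<omega>) (R \<omega>)) \<in> borel_measurable M"
    using distributed_measurable[OF dist] by simp
  have X_meas [measurable]: "X \<in> borel_measurable M"
    using measurable_compose[OF V_meas measurable_fst_block] by simp
  have R_meas [measurable]: "R \<in> borel_measurable M"
    using measurable_compose[OF V_meas measurable_snd_block] by simp

  have int: "integrable M (\<lambda>\<omega>. stack (X \<omega>) (R \<omega>))"
    by (rule integrable_of_square_integrable_norm[OF V_meas assms(9)])
  have neg_form: "(- w) \<bullet> (E *v (- w)) = w \<bullet> (E *v w)" for w :: "real ^ ('k + 'l)" and E
    using quadratic_form_scale[of "- 1" w E] by simp
  have mean: "(\<integral>\<omega>. stack (X \<omega>) (R \<omega>) \<partial>M) = \<mu>"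
  proof (rule expectation_symmetric_density[OF dist _ _ int])
    show "0 \<le> f v" for v
      unfolding f using \<open>0 < c\<close> nonneg positive_definite_inv_form_nonneg[OF S] by simp
    show "f (2 *\<^sub>R \<mu> - v) = f v" for v
    proof -
      have "2 *\<^sub>R \<mu> - v - \<mu> = - (v - \<mu>)" by (simp add: scaleR_2)
      then show ?thesis unfolding f by (simp only: neg_form)
    qed
  qed
  have "(\<integral>\<omega>. X \<omega> \<partial>M) = fst_block \<mu>"
    using integral_bounded_linear[OF linear_fst_block[unfolded linear_conv_bounded_linear] int]
    by (simp add: mean)
  moreover have "(\<integral>\<omega>. R \<omega> \<partial>M) = snd_block \<mu>"
    using integral_bounded_linear[OF linear_snd_block[unfolded linear_conv_bounded_linear] int]
    by (simp add: mean)
  ultimately have T: "T_c M X R \<omega> = R \<omega> - snd_block \<mu> - B *v (X \<omega> - fst_block \<mu>)" for \<omega>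
    by (simp add: T_c_def centered_def B_def)
  have [measurable]: "(\<lambda>z. B *v z) \<in> borel_measurable borel"
    by (intro borel_measurable_linear matrix_vector_mul_linear)
  have T_meas [measurable]: "T_c M X R \<in> borel_measurable M"
    unfolding T by measurable
  have "(\<lambda>z. z \<bullet> (matrix_inv A *v z)) \<in> borel_measurable borel"
    by (intro borel_measurable_continuous_onI continuous_intros)
  then have form_meas: "(\<lambda>\<omega>. T_c M X R \<omega> \<bullet> (matrix_inv A *v T_c M X R \<omega>)) \<in> borel_measurable M"
    by measurable

  have "0 \<le> b"
    unfolding b_def using assms by (intro upper_quantile_nonneg) simp_all
  have B_inf: "B_inf M R \<alpha> = {r. (norm r)\<^sup>2 \<le> b}"
    using \<open>0 \<le> b\<close> by (auto simp: B_inf_def b_def[symmetric] real_le_rsqrt sqrt_le_D abs_le_square_iff)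
      (metis norm_ge_zero real_sqrt_le_iff real_sqrt_unique sqrt_le_D)
  (* Were the ellipsoid larger, a slightly smaller one would still dominate the ball in volume, hence
     have probability at least 1 - \<alpha> for the residual, although its level lies below the quantile. *)
  have "emeasure lebesgue (ellipsoid A q) \<le> emeasure lebesgue (B_inf M R \<alpha>)"
  proof (rule ccontr)
    assume "\<not> ?thesis"
    then obtain q' where q': "0 \<le> q'" "q' < q"
      "emeasure lebesgue (B_inf M R \<alpha>) \<le> emeasure lebesgue (ellipsoid A q')"
      using ellipsoid_shrink[OF A, of "B_inf M R \<alpha>" q] by (auto simp: not_le)
    have "ennreal (1 - \<alpha>) \<le> emeasure M {\<omega> \<in> space M. R \<omega> \<in> B_inf M R \<alpha>}"
      using prob_le_upper_quantile[of "\<lambda>\<omega>. (norm (R \<omega>))\<^sup>2" \<alpha>] assms(2)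
      by (simp add: B_inf b_def[symmetric] emeasure_eq_measure)
    also have "\<dots> \<le> emeasure M {\<omega> \<in> space M.
        R \<omega> - snd_block \<mu> - B *v (X \<omega> - fst_block \<mu>) \<in> ellipsoid A q'}"
      unfolding A_def A_inf_def B_def regression_matrix_def
      by (rule elliptical_concentration[OF S nonneg decr \<open>0 < c\<close> f dist])
         (use q' in \<open>simp_all add: A_def A_inf_def B_inf_def\<close>)
    also have "\<dots> = emeasure M {\<omega> \<in> space M. T_c M X R \<omega> \<bullet> (matrix_inv A *v T_c M X R \<omega>) \<le> q'}"
      by (simp add: T ellipsoid_def)
    also have "\<dots> < ennreal (1 - \<alpha>)"
      using prob_le_below_upper_quantile[OF form_meas, of \<alpha> q'] positive_definite_inv_form_nonneg[OF A] assms(3) q'(2)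
      by (simp add: q_def q_F_def A_def emeasure_eq_measure ennreal_less_iff)
    finally show False by simp
  qed
  (* The random centre only translates the ellipsoid, so the inequality holds for every outcome. *)
  moreover have "emeasure lebesgue (F_inf M X R \<alpha> \<omega>) = emeasure lebesgue (ellipsoid A q)" for \<omega>
    unfolding F_inf_def A_def q_def by (rule emeasure_ellipsoid_translate)
  ultimately show ?thesis by simp
qed

end
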